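(* Let $-1<q\le 1$, $|\rho|<1$ and $x,y\in\mathbb{R}$. For all integers $n\ge 0$: (i) $$U_n\!\left(x\sqrt{1-q}/2\right)=\sum_{k=0}^{n} D_{k,n}(y,\rho,q)\,P_k(x|y,\rho,q),$$ where $$D_{k,n}(y,\rho,q)=\sum_{j=0}^{\lfloor (n-k)/2\rfloor}(-1)^j(1-q)^{n/2-j}q^{j(j+1)/2}\begin{bmatrix} n-j\\ n-k-j\end{bmatrix}_q\begin{bmatrix} n-k-j\\ n-k-2j\end{bmatrix}_q\rho^{n-k-2j}H_{n-k-2j}(y|q).$$ (ii) $$k_n\!\left(x\sqrt{1-q}\,\big|\,y\sqrt{1-q},\rho\right)=\sum_{k=0}^{n} C_{k,n}(y,\rho,q)\,P_k(x|y,\rho,q),$$ where $C_{0,0}(y,\rho,q)=1$ and, for $n\ge 1$, $0\le k\le n$, $$C_{k,n}(y,\rho,q)=\sum_{j=0}^{\lfloor (n-k)/2\rfloor}(-1)^j(1-q)^{n/2-j}q^{n-k+j(j-3)/2}\begin{bmatrix} n-1-j\\ n-k-2j\end{bmatrix}_q\left(\begin{bmatrix} j+k\\ k\end{bmatrix}_q-\rho^2q^k\begin{bmatrix} j+k-1\\ k\end{bmatrix}_q\right)\rho^{n-k-2j}H_{n-k-2j}(y|q).$$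
   Context: Notation: $[0]_q=0$, $[n]_q=1+q+\dots+q^{n-1}$, $[n]_q!=\prod_{i=1}^n[i]_q$ with $[0]_q!=1$, and $\begin{bmatrix} n\\ k\end{bmatrix}_q=\frac{[n]_q!}{[n-k]_q!\,[k]_q!}$ if $n\ge k\ge 0$, and $0$ otherwise. The convention $0^0=1$ is used. $U_n$ are the Chebyshev polynomials of the second kind: $U_{-1}=0$, $U_0=1$, $2xU_n(x)=U_{n+1}(x)+U_{n-1}(x)$ for $n\ge0$. $q$-Hermite polynomials: $H_{-1}(x|q)=0$, $H_0(x|q)=1$, $H_{n+1}(x|q)=xH_n(x|q)-[n]_qH_{n-1}(x|q)$. Al-Salam--Chihara polynomials: $P_{-1}(x|y,\rho,q)=0$, $P_0(x|y,\rho,q)=1$, $P_{n+1}(x|y,\rho,q)=(x-\rho yq^n)P_n(x|y,\rho,q)-(1-\rho^2q^{n-1})[n]_qP_{n-1}(x|y,\rho,q)$ for $n\ge 0$ (the last term being $0$ for $n=0$). $k_n(x|y,\rho)=P_n(x|y,\rho,0)$; explicitly $k_0=1$, $k_1(x|y,\rho)=x-\rho y$, and $k_n(x|y,\rho)=U_n(x/2)-\rho yU_{n-1}(x/2)+\rho^2U_{n-2}(x/2)$ for $n\ge 2$. *)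

theory Defs
  imports Complex_Main
begin

definition q_nat :: "real \<Rightarrow> nat \<Rightarrow> real" where
  "q_nat q n = (\<Sum>i<n. q ^ i)"

definition q_fact :: "real \<Rightarrow> nat \<Rightarrow> real" where
  "q_fact q n = (\<Prod>i=1..n. q_nat q i)"

(* The arguments are integers because the upper one can be -1, where the value must be 0;
   truncated subtraction on nat would turn this into "0 choose 0" = 1. *)
definition q_binom :: "real \<Rightarrow> int \<Rightarrow> int \<Rightarrow> real" where
  "q_binom q n k =
     (if 0 \<le> k \<and> k \<le> n
      then q_fact q (nat n) / (q_fact q (nat (n - k)) * q_fact q (nat k)) else 0)"

(* In the three recurrences below the value at index 1 is what the general recurrence
   gives from the values 0 at index -1 and 1 at index 0. *)

fun Cheb_U :: "nat \<Rightarrow> real \<Rightarrow> real" where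
  "Cheb_U 0 x = 1"
| "Cheb_U (Suc 0) x = 2 * x"
| "Cheb_U (Suc (Suc n)) x = 2 * x * Cheb_U (Suc n) x - Cheb_U n x"

fun q_Hermite :: "real \<Rightarrow> nat \<Rightarrow> real \<Rightarrow> real" where
  "q_Hermite q 0 x = 1"
| "q_Hermite q (Suc 0) x = x"
| "q_Hermite q (Suc (Suc n)) x =
     x * q_Hermite q (Suc n) x - q_nat q (Suc n) * q_Hermite q n x"

(* ASC n x y \<rho> q is the Al-Salam--Chihara polynomial P_n(x | y, \<rho>, q). *)
fun ASC :: "nat \<Rightarrow> real \<Rightarrow> real \<Rightarrow> real \<Rightarrow> real \<Rightarrow> real" where
  "ASC 0 x y \<rho> q = 1"
| "ASC (Suc 0) x y \<rho> q = x - \<rho> * y"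
| "ASC (Suc (Suc n)) x y \<rho> q =
     (x - \<rho> * y * q ^ Suc n) * ASC (Suc n) x y \<rho> q
       - (1 - \<rho>\<^sup>2 * q ^ n) * q_nat q (Suc n) * ASC n x y \<rho> q"

definition k_poly :: "nat \<Rightarrow> real \<Rightarrow> real \<Rightarrow> real \<Rightarrow> real" where
  "k_poly n x y \<rho> = ASC n x y \<rho> 0"

(* The factor (1 - q) to the power n/2 - j is written as sqrt (1 - q) ^ (n - 2 * j), with
   n - 2 * j \<ge> k \<ge> 0 in the range of summation. This keeps the convention 0^0 = 1, needed
   for q = 1, whereas 0 powr 0 = 0. *)

definition D_coeff :: "nat \<Rightarrow> nat \<Rightarrow> real \<Rightarrow> real \<Rightarrow> real \<Rightarrow> real" where
  "D_coeff k n y \<rho> q =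
     (\<Sum>j = 0..(n - k) div 2.
        (- 1) ^ j * sqrt (1 - q) ^ (n - 2 * j) * q ^ (j * (j + 1) div 2)
        * q_binom q (int n - int j) (int n - int k - int j)
        * q_binom q (int n - int k - int j) (int n - int k - 2 * int j)
        * \<rho> ^ (n - k - 2 * j) * q_Hermite q (n - k - 2 * j) y)"

(* j (j - 3) / 2 can be negative, hence the integer exponent of q. The whole exponent is at
   least j (j + 1) / 2 in the range of summation, so q = 0 is unproblematic. *)
definition C_coeff :: "nat \<Rightarrow> nat \<Rightarrow> real \<Rightarrow> real \<Rightarrow> real \<Rightarrow> real" where
  "C_coeff k n y \<rho> q =
     (if n = 0 then 1
      else \<Sum>j = 0..(n - k) div 2.
        (- 1) ^ j * sqrt (1 - q) ^ (n - 2 * j)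
        * q powi (int n - int k + (int j * (int j - 3)) div 2)
        * q_binom q (int n - 1 - int j) (int n - int k - 2 * int j)
        * (q_binom q (int j + int k) (int k)
             - \<rho>\<^sup>2 * q ^ k * q_binom q (int j + int k - 1) (int k))
        * \<rho> ^ (n - k - 2 * j) * q_Hermite q (n - k - 2 * j) y)"

end

theory Submission
  imports Defs
begin

text \<open>
  Put \<open>s = sqrt (1 - q)\<close>, and write \<open>j\<close> for the summation index and \<open>m = n - k - 2 * j\<close> for the index
  of the \<open>q\<close>-Hermite polynomial. The product of \<open>q\<close>-binomials in \<open>D\<^bsub>k,n\<^esub>\<close> is the
  \<open>q\<close>-trinomial coefficient \<open>[j + k + m]! / ([j]! [k]! [m]!)\<close>, so (i) expands \<open>U\<^sub>n\<close> over the triples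
  \<open>(j, k, m)\<close> with \<open>2 * j + k + m = n\<close>. Inserting the three-term recurrences of \<open>P\<^sub>k\<close> and of
  \<open>H\<^sub>m\<close> into \<open>U\<^bsub>n+2\<^esub> = s x U\<^bsub>n+1\<^esub> - U\<^sub>n\<close>, the terms with \<open>\<rho>\<^sup>2\<close> cancel, and comparing
  coefficients leaves the Pascal rule of the \<open>q\<close>-trinomials. Claim (ii) follows from (i)
  and \<open>k\<^sub>n = U\<^sub>n - \<rho> y s U\<^bsub>n-1\<^esub> + \<rho>\<^sup>2 U\<^bsub>n-2\<^esub>\<close> by comparing coefficients in the same way.
\<close>

section \<open>\<open>q\<close>-numbers and \<open>q\<close>-factorials\<close>

lemma q_nat_0 [simp]: "q_nat q 0 = 0"
  by (simp add: q_nat_def)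

lemma q_nat_add: "q_nat q (a + b) = q_nat q a + q ^ a * q_nat q b"
  by (induction b) (simp_all add: q_nat_def algebra_simps power_add)

lemma one_minus_mult_q_nat: "(1 - q) * q_nat q n = 1 - q ^ n"
  by (simp add: q_nat_def one_diff_power_eq)

text \<open>For negative \<open>q\<close> the powers alternate in sign, so positivity is read off
  from (1 - q) [n]_q = 1 - q^n with |q| < 1. It justifies all later divisions by
  \<open>q\<close>-factorials.\<close>

lemma q_nat_pos:
  assumes "- 1 < q" "q \<le> 1" "0 < n"
  shows "0 < q_nat q n"
proof (cases "q = 1")
  case True
  then show ?thesis using assms by (simp add: q_nat_def)
next
  case False
  then have "\<bar>q\<bar> < 1" using assms by auto
  then have "\<bar>q\<bar> ^ n < 1" using assms by (simp add: power_Suc_less_one power_less_one_iff)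
  then have "0 < (1 - q) * q_nat q n"
    unfolding one_minus_mult_q_nat by (simp add: abs_less_iff flip: power_abs)
  then show ?thesis using False assms by (simp add: zero_less_mult_iff)
qed

lemma q_fact_0 [simp]: "q_fact q 0 = 1"
  by (simp add: q_fact_def)

lemma q_fact_Suc [simp]: "q_fact q (Suc n) = q_nat q (Suc n) * q_fact q n"
  by (simp add: q_fact_def mult.commute)

lemma q_fact_pos:
  assumes "- 1 < q" "q \<le> 1"
  shows "0 < q_fact q n"
  unfolding q_fact_def using assms by (intro prod_pos) (auto intro: q_nat_pos)

section \<open>Summands of the two expansions, indexed by triples\<close>

definition q_trinom :: "real \<Rightarrow> nat \<Rightarrow> nat \<Rightarrow> nat \<Rightarrow> real" where
  "q_trinom q j k m = q_fact q (j + k + m) / (q_fact q j * q_fact q k * q_fact q m)"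

definition D_term :: "real \<Rightarrow> nat \<Rightarrow> nat \<Rightarrow> nat \<Rightarrow> real" where
  "D_term q j k m =
     (- 1) ^ j * sqrt (1 - q) ^ (k + m) * q ^ (j * (j + 1) div 2) * q_trinom q j k m"

text \<open>With n = 2j + k + m the exponent n - k + j(j - 3)/2 becomes m + j(j + 1)/2, a natural
  number. The binomials keep integer arguments because their upper index can be -1.\<close>

definition C_term :: "real \<Rightarrow> real \<Rightarrow> nat \<Rightarrow> nat \<Rightarrow> nat \<Rightarrow> real" where
  "C_term q \<rho> j k m =
     (- 1) ^ j * sqrt (1 - q) ^ (k + m) * q ^ (m + j * (j + 1) div 2)
     * q_binom q (int (j + k + m) - 1) (int m)
     * (q_binom q (int j + int k) (int k) - \<rho>\<^sup>2 * q ^ k * q_binom q (int j + int k - 1) (int k))"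

section \<open>Sums over triples and index shifts\<close>

definition triples :: "nat \<Rightarrow> (nat \<times> nat \<times> nat) set" where
  "triples n = {(j, k, m). 2 * j + k + m = n}"

lemma finite_triples [simp]: "finite (triples n)"
  by (rule finite_subset[of _ "{..n} \<times> {..n} \<times> {..n}"]) (auto simp: triples_def)

text \<open>The terms with \<open>j = 0\<close> vanish, and lowering \<open>j\<close> by one lowers
  2j + k + m by two. In this and the next two shifts, the vanishing comes from an \<open>if\<close>
  or from a factor [0]_q.\<close>

lemma sum_triples_first:
  assumes "\<And>k m. F 0 k m = (0::real)"
  shows "(\<Sum>(j, k, m)\<in>triples (Suc (Suc n)). F j k m) = (\<Sum>(j, k, m)\<in>triples n. F (Suc j) k m)"
proof -
  have "(\<Sum>(j, k, m)\<in>triples (Suc (Suc n)). F j k m) = (\<Sum>(j, k, m)\<in>{p \<in> triples (Suc (Suc n)). fst p \<noteq> 0}. F j k m)"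
    by (rule sum.mono_neutral_right) (auto, metis assms neq0_conv)
  also have "\<dots> = (\<Sum>(j, k, m)\<in>triples n. F (Suc j) k m)"
    by (rule sum.reindex_bij_witness[where i = "\<lambda>(j, k, m). (Suc j, k, m)" and j = "\<lambda>(j, k, m). (j - 1, k, m)"])
       (auto simp: triples_def)
  finally show ?thesis .
qed

lemma sum_triples_second:
  assumes "\<And>j m. F j 0 m = (0::real)"
  shows "(\<Sum>(j, k, m)\<in>triples (Suc n). F j k m) = (\<Sum>(j, k, m)\<in>triples n. F j (Suc k) m)"
proof -
  have "(\<Sum>(j, k, m)\<in>triples (Suc n). F j k m) = (\<Sum>(j, k, m)\<in>{p \<in> triples (Suc n). (fst \<circ> snd) p \<noteq> 0}. F j k m)"
    by (rule sum.mono_neutral_right) (auto, metis assms neq0_conv)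
  also have "\<dots> = (\<Sum>(j, k, m)\<in>triples n. F j (Suc k) m)"
    by (rule sum.reindex_bij_witness[where i = "\<lambda>(j, k, m). (j, Suc k, m)" and j = "\<lambda>(j, k, m). (j, k - 1, m)"])
       (auto simp: triples_def)
  finally show ?thesis .
qed

lemma sum_triples_third:
  assumes "\<And>j k. F j k 0 = (0::real)"
  shows "(\<Sum>(j, k, m)\<in>triples (Suc n). F j k m) = (\<Sum>(j, k, m)\<in>triples n. F j k (Suc m))"
proof -
  have "(\<Sum>(j, k, m)\<in>triples (Suc n). F j k m) = (\<Sum>(j, k, m)\<in>{p \<in> triples (Suc n). (snd \<circ> snd) p \<noteq> 0}. F j k m)"
    by (rule sum.mono_neutral_right) (auto, metis assms neq0_conv)
  also have "\<dots> = (\<Sum>(j, k, m)\<in>triples n. F j k (Suc m))"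
    by (rule sum.reindex_bij_witness[where i = "\<lambda>(j, k, m). (j, k, Suc m)" and j = "\<lambda>(j, k, m). (j, k, m - 1)"])
       (auto simp: triples_def)
  finally show ?thesis .
qed

lemma sum_triples:
  "(\<Sum>(j, k, m)\<in>triples n. F j k m) = (\<Sum>k = 0..n. \<Sum>j = 0..(n - k) div 2. (F j k (n - k - 2 * j) :: real))"
proof -
  have "(\<Sum>k = 0..n. \<Sum>j = 0..(n - k) div 2. F j k (n - k - 2 * j))
      = (\<Sum>(k, j)\<in>(SIGMA k:{0..n}. {0..(n - k) div 2}). F j k (n - k - 2 * j))"
    by (simp add: sum.Sigma)
  also have "\<dots> = (\<Sum>(j, k, m)\<in>triples n. F j k m)"
    by (rule sum.reindex_bij_witness[where
          i = "\<lambda>(j, k, m). (k, j)" and j = "\<lambda>(k, j). (j, k, n - k - 2 * j)"])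
       (auto simp: triples_def)
  finally show ?thesis by simp
qed

section \<open>Recurrences of the three polynomial families\<close>

text \<open>The defining recurrence solved for x P_k. At \<open>k = 0\<close> the truncated
  \<open>k - 1\<close> is harmless, since its term carries the factor [0]_q = 0; the same holds for
  the \<open>q\<close>-Hermite version below.\<close>

lemma mult_ASC:
  "x * ASC k x y \<rho> q = ASC (Suc k) x y \<rho> q + \<rho> * y * q ^ k * ASC k x y \<rho> q
     + (1 - \<rho>\<^sup>2 * q ^ (k - 1)) * q_nat q k * ASC (k - 1) x y \<rho> q"
  by (cases k) (simp_all add: algebra_simps)

lemma mult_q_Hermite:
  "y * q_Hermite q m y = q_Hermite q (Suc m) y + q_nat q m * q_Hermite q (m - 1) y"
  by (cases m) simp_all

text \<open>At q = 0 the recurrence of k_n is the Chebyshev one from index 3 on; at index 2 the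
  value 0^0 = 1 leaves an extra \<rho>^2. The recurrence for k_3 still reaches back to k_1, outside
  the formula, so k_2 and k_3 are both base cases.\<close>

lemma k_poly_eq_Cheb_U:
  "k_poly (Suc (Suc n)) x y \<rho>
     = Cheb_U (Suc (Suc n)) (x / 2) - \<rho> * y * Cheb_U (Suc n) (x / 2) + \<rho>\<^sup>2 * Cheb_U n (x / 2)"
proof (induction n rule: less_induct)
  case (less n)
  have q_nat_0_Suc: "q_nat 0 (Suc i) = 1" for i
    by (induction i) (simp_all add: q_nat_def)
  consider "n = 0" | "n = Suc 0" | i where "n = Suc (Suc i)"
    by (metis not0_implies_Suc)
  then show ?case
  proof cases
    case 1
    then show ?thesis by (simp add: k_poly_def q_nat_0_Suc algebra_simps)
  next
    case 2
    then show ?thesis by (simp add: k_poly_def q_nat_0_Suc algebra_simps power2_eq_square)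
  next
    case 3
    have IH: "k_poly (Suc (Suc i)) x y \<rho> = Cheb_U (Suc (Suc i)) (x / 2)
          - \<rho> * y * Cheb_U (Suc i) (x / 2) + \<rho>\<^sup>2 * Cheb_U i (x / 2)"
      "k_poly (Suc (Suc (Suc i))) x y \<rho> = Cheb_U (Suc (Suc (Suc i))) (x / 2)
          - \<rho> * y * Cheb_U (Suc (Suc i)) (x / 2) + \<rho>\<^sup>2 * Cheb_U (Suc i) (x / 2)"
      using less[of i] less[of "Suc i"] 3 by simp_all
    have "k_poly (Suc (Suc n)) x y \<rho> = x * k_poly (Suc n) x y \<rho> - k_poly n x y \<rho>"
      using 3 by (simp add: k_poly_def q_nat_0_Suc)
    also have "\<dots> = Cheb_U (Suc (Suc n)) (x / 2) - \<rho> * y * Cheb_U (Suc n) (x / 2)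
        + \<rho>\<^sup>2 * Cheb_U n (x / 2)"
      unfolding 3 IH by (simp add: algebra_simps)
    finally show ?thesis .
  qed
qed

section \<open>Identities for \<open>q\<close>-trinomials and \<open>q\<close>-binomials\<close>

context
  fixes q :: real
  assumes q: "- 1 < q" "q \<le> 1"
begin

lemma q_nat_Suc_neq_0: "q_nat q (Suc n) \<noteq> 0"
  using q_nat_pos[OF q, of "Suc n"] by simp

lemma q_fact_neq_0: "q_fact q n \<noteq> 0"
  using q_fact_pos[OF q, of n] by simp

lemma q_trinom_Suc:
  "q_nat q (Suc j) * q_trinom q (Suc j) k m = q_nat q (Suc (j + k + m)) * q_trinom q j k m"
  "q_nat q (Suc k) * q_trinom q j (Suc k) m = q_nat q (Suc (j + k + m)) * q_trinom q j k m"
  "q_nat q (Suc m) * q_trinom q j k (Suc m) = q_nat q (Suc (j + k + m)) * q_trinom q j k m"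
  using q_nat_Suc_neq_0 q_fact_neq_0 by (simp_all add: q_trinom_def field_simps)

text \<open>The absorption rules moved down by one. Each \<open>if\<close> stands for a trinomial
  that vanishes at a negative index, so at index 0 both sides are 0.\<close>

lemma q_trinom_pred:
  "q_nat q (j + k + m) * (if j = 0 then 0 else q_trinom q (j - 1) k m) = q_nat q j * q_trinom q j k m"
  "q_nat q (j + k + m) * (if k = 0 then 0 else q_trinom q j (k - 1) m) = q_nat q k * q_trinom q j k m"
  "q_nat q (j + k + m) * (if m = 0 then 0 else q_trinom q j k (m - 1)) = q_nat q m * q_trinom q j k m"
  using q_trinom_Suc(1)[of "j - 1" k m] q_trinom_Suc(2)[of "k - 1" j m] q_trinom_Suc(3)[of "m - 1" j k]
  by auto

text \<open>Multiply by [j + k + m]_q and split it in the order k, m, j, which produces the weights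
  1, q^k and q^(k+m); absorption then lowers one index in each part.\<close>

lemma q_trinom_Pascal:
  assumes "0 < j + k + m"
  shows "q_trinom q j k m = (if k = 0 then 0 else q_trinom q j (k - 1) m)
    + q ^ k * (if m = 0 then 0 else q_trinom q j k (m - 1))
    + q ^ (k + m) * (if j = 0 then 0 else q_trinom q (j - 1) k m)" (is "_ = ?K + _ * ?M + _ * ?J")
proof -
  let ?N = "q_nat q (j + k + m)"
  have "?N = q_nat q (k + m + j)" by (simp add: add_ac)
  then have N: "?N = q_nat q k + q ^ k * q_nat q m + q ^ (k + m) * q_nat q j"
    by (simp only: q_nat_add)
  have "?N * q_trinom q j k m = q_nat q k * q_trinom q j k m
      + q ^ k * (q_nat q m * q_trinom q j k m) + q ^ (k + m) * (q_nat q j * q_trinom q j k m)"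
    unfolding N by (simp add: algebra_simps)
  also have "\<dots> = ?N * (?K + q ^ k * ?M + q ^ (k + m) * ?J)"
    unfolding q_trinom_pred[symmetric] by (simp only: algebra_simps)
  finally show ?thesis using q_nat_pos[OF q assms] by (simp del: q_nat_0)
qed

lemma q_binom_nat:
  "q_binom q (int (a + b)) (int b) = q_fact q (a + b) / (q_fact q a * q_fact q b)"
  by (simp add: q_binom_def nat_add_distrib)

lemma q_binom_mult_q_binom:
  "q_binom q (int (j + k + m)) (int (j + m)) * q_binom q (int (j + m)) (int m) = q_trinom q j k m"
  using q_binom_nat[of k "j + m"] q_binom_nat[of j m] q_fact_neq_0
  by (simp add: q_trinom_def add_ac)

text \<open>After multiplication by [j + k + m]_q the left side is q^m [j + k]_q times the
  trinomial, and q^m [j + k]_q = [j + k + m]_q - [m]_q.\<close>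

lemma q_binom_trinom_diff:
  assumes "0 < j + k + m"
  shows "q ^ m * q_binom q (int (j + k + m) - 1) (int m) * q_binom q (int j + int k) (int k)
    = q_trinom q j k m - (if m = 0 then 0 else q_trinom q j k (m - 1))" (is "?L = ?R")
proof -
  let ?N = "q_nat q (j + k + m)"
  have *: "?N * (q_binom q (int (j + k + m) - 1) (int m) * q_binom q (int j + int k) (int k))
      = q_nat q (j + k) * q_trinom q j k m"
  proof (cases "j + k")
    \<comment> \<open>The upper index m - 1 is below the lower index m, so the binomial is 0,
      matching [0]_q on the right.\<close>
    case 0
    then show ?thesis by (simp add: q_binom_def)
  next
    case (Suc i)
    then have "int (j + k + m) - 1 = int (i + m)" by simp
    moreover have "j + k + m = Suc (i + m)" using Suc by simp
    ultimately show ?thesis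
      using Suc q_binom_nat[of j k] q_fact_neq_0 q_nat_Suc_neq_0
      by (simp only: q_binom_nat q_trinom_def q_fact_Suc of_nat_add[symmetric])
         (simp add: field_simps)
  qed
  have "?N = q_nat q (m + (j + k))" by (simp add: add_ac)
  then have N: "?N = q_nat q m + q ^ m * q_nat q (j + k)"
    by (simp only: q_nat_add)
  have "?N * ?L = q ^ m * (q_nat q (j + k) * q_trinom q j k m)"
    unfolding *[symmetric] by simp
  also have "\<dots> = ?N * q_trinom q j k m - q_nat q m * q_trinom q j k m"
    unfolding N by (simp add: algebra_simps)
  also have "\<dots> = ?N * ?R"
    unfolding q_trinom_pred[symmetric] by (simp only: algebra_simps)
  finally show ?thesis using q_nat_pos[OF q assms] by simp
qed

lemma q_binom_trinom_pred:
  "q_binom q (int (j + k + m) - 1) (int m) * q_binom q (int j + int k - 1) (int k)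
    = (if j = 0 then 0 else q_trinom q (j - 1) k m)"
proof (cases j)
  \<comment> \<open>The second binomial has upper index k - 1 and lower index k; it is 0 even for
    \<open>k = 0\<close>, where the upper index is -1.\<close>
  case 0
  then show ?thesis by (simp add: q_binom_def)
next
  case (Suc i)
  then have "int (j + k + m) - 1 = int ((i + k) + m)" "int j + int k - 1 = int (i + k)" by simp_all
  then show ?thesis
    using Suc q_fact_neq_0 by (simp only: q_binom_nat q_trinom_def) (simp add: field_simps)
qed

section \<open>Identities for \<open>D_term\<close> and \<open>C_term\<close>\<close>

lemma triangle_Suc: "Suc j * (Suc j + 1) div 2 = j * (j + 1) div 2 + Suc j"
proof -
  have "Suc j * (Suc j + 1) = j * (j + 1) + 2 * Suc j" by simp
  then show ?thesis by simp
qed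

lemma sqrt_mult_sqrt: "sqrt (1 - q) * (sqrt (1 - q) * z) = (1 - q) * z"
  using q by (simp flip: mult.assoc)

text \<open>Raising \<open>k\<close> or \<open>m\<close> brings a second square root, and (1 - q)
  [N]_q = 1 - q^N with N = j + k + m + 1. Thus [k]_q from the recurrence of P_k and [m]_q from that
  of H_m yield the same factor, which lets the \<rho>^2 terms cancel.\<close>

lemma D_term_Suc:
  "sqrt (1 - q) * (q_nat q (Suc k) * D_term q j (Suc k) m) = (1 - q ^ Suc (j + k + m)) * D_term q j k m"
  "sqrt (1 - q) * (q_nat q (Suc m) * D_term q j k (Suc m)) = (1 - q ^ Suc (j + k + m)) * D_term q j k m"
proof -
  let ?c = "(- 1) ^ j * sqrt (1 - q) ^ (k + m) * q ^ (j * (j + 1) div 2)"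
  have "sqrt (1 - q) * (q_nat q (Suc k) * D_term q j (Suc k) m)
      = sqrt (1 - q) * (sqrt (1 - q) * (?c * (q_nat q (Suc k) * q_trinom q j (Suc k) m)))"
    by (simp add: D_term_def mult_ac)
  also have "\<dots> = ((1 - q) * q_nat q (Suc (j + k + m))) * D_term q j k m"
    by (simp only: sqrt_mult_sqrt q_trinom_Suc D_term_def mult_ac)
  finally show "sqrt (1 - q) * (q_nat q (Suc k) * D_term q j (Suc k) m)
      = (1 - q ^ Suc (j + k + m)) * D_term q j k m"
    by (simp only: one_minus_mult_q_nat)
  have "sqrt (1 - q) * (q_nat q (Suc m) * D_term q j k (Suc m))
      = sqrt (1 - q) * (sqrt (1 - q) * (?c * (q_nat q (Suc m) * q_trinom q j k (Suc m))))"
    by (simp add: D_term_def mult_ac)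
  also have "\<dots> = ((1 - q) * q_nat q (Suc (j + k + m))) * D_term q j k m"
    by (simp only: sqrt_mult_sqrt q_trinom_Suc D_term_def mult_ac)
  finally show "sqrt (1 - q) * (q_nat q (Suc m) * D_term q j k (Suc m))
      = (1 - q ^ Suc (j + k + m)) * D_term q j k m"
    by (simp only: one_minus_mult_q_nat)
qed

text \<open>The trinomial Pascal rule with signs and powers restored: lowering \<open>j\<close>
  flips the sign and releases q^j, turning q^(k+m) into q^(j+k+m).\<close>

lemma D_term_Pascal:
  assumes "0 < j + k + m"
  shows "D_term q j k m = (if k = 0 then 0 else sqrt (1 - q) * D_term q j (k - 1) m)
    + (if m = 0 then 0 else sqrt (1 - q) * q ^ k * D_term q j k (m - 1))
    - (if j = 0 then 0 else q ^ (j + k + m) * D_term q (j - 1) k m)"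
proof -
  let ?c = "(- 1) ^ j * sqrt (1 - q) ^ (k + m) * q ^ (j * (j + 1) div 2)"
  have 1: "?c * (if k = 0 then 0 else q_trinom q j (k - 1) m)
      = (if k = 0 then 0 else sqrt (1 - q) * D_term q j (k - 1) m)"
    by (cases k) (simp_all add: D_term_def)
  have 2: "?c * (q ^ k * (if m = 0 then 0 else q_trinom q j k (m - 1)))
      = (if m = 0 then 0 else sqrt (1 - q) * q ^ k * D_term q j k (m - 1))"
    by (cases m) (simp_all add: D_term_def)
  have 3: "?c * (q ^ (k + m) * (if j = 0 then 0 else q_trinom q (j - 1) k m))
      = - (if j = 0 then 0 else q ^ (j + k + m) * D_term q (j - 1) k m)"
  proof (cases j)
    case (Suc i)
    show ?thesis unfolding Suc triangle_Suc by (simp add: D_term_def power_add mult_ac)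
  qed simp
  have distrib: "c * (u + v + w) = c * u + c * v + c * w" for c u v w :: real
    by (simp add: distrib_left)
  show ?thesis
    unfolding D_term_def[of q j k m] q_trinom_Pascal[OF assms] distrib 1 2 3 by simp
qed

text \<open>This is k_n = U_n - \<rho> y s U_{n-1} + \<rho>^2 U_{n-2} at the level of coefficients.
  The first binomial in the bracket of \<open>C_term\<close> gives the difference of trinomials, the
  second the term with \<open>j\<close> lowered.\<close>

lemma C_term_eq_D_term:
  assumes "0 < j + k + m"
  shows "C_term q \<rho> j k m = D_term q j k m
    - (if m = 0 then 0 else sqrt (1 - q) * D_term q j k (m - 1))
    + (if j = 0 then 0 else \<rho>\<^sup>2 * q ^ (j + k + m) * D_term q (j - 1) k m)"
proof -
  let ?c = "(- 1) ^ j * sqrt (1 - q) ^ (k + m) * q ^ (j * (j + 1) div 2)"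
  have "C_term q \<rho> j k m = ?c * (q ^ m * q_binom q (int (j + k + m) - 1) (int m)
        * q_binom q (int j + int k) (int k))
      - \<rho>\<^sup>2 * (?c * q ^ (k + m) * (q_binom q (int (j + k + m) - 1) (int m)
        * q_binom q (int j + int k - 1) (int k)))"
    by (simp only: C_term_def power_add algebra_simps)
  also have "\<dots> = ?c * (q_trinom q j k m - (if m = 0 then 0 else q_trinom q j k (m - 1)))
      - \<rho>\<^sup>2 * (?c * q ^ (k + m) * (if j = 0 then 0 else q_trinom q (j - 1) k m))"
    by (simp only: q_binom_trinom_diff[OF assms] q_binom_trinom_pred)
  also have "?c * (q_trinom q j k m - (if m = 0 then 0 else q_trinom q j k (m - 1)))
      = D_term q j k m - (if m = 0 then 0 else sqrt (1 - q) * D_term q j k (m - 1))"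
    by (cases m) (simp_all add: D_term_def algebra_simps)
  also have "?c * q ^ (k + m) * (if j = 0 then 0 else q_trinom q (j - 1) k m)
      = - (if j = 0 then 0 else q ^ (j + k + m) * D_term q (j - 1) k m)"
  proof (cases j)
    case (Suc i)
    show ?thesis unfolding Suc triangle_Suc by (simp add: D_term_def power_add mult_ac)
  qed simp
  finally show ?thesis by (auto simp: algebra_simps)
qed

section \<open>From the stated coefficients to sums over triples\<close>

lemma sum_D_coeff_eq:
  "(\<Sum>k = 0..n. D_coeff k n y \<rho> q * f k)
    = (\<Sum>(j, k, m)\<in>triples n. D_term q j k m * (\<rho> ^ m * q_Hermite q m y) * f k)"
  unfolding sum_triples D_coeff_def sum_distrib_right
proof (intro sum.cong refl)
  fix k j assume "k \<in> {0..n}" "j \<in> {0..(n - k) div 2}"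
  then have "n = 2 * j + k + (n - k - 2 * j)" by auto
  then obtain m where n: "n = 2 * j + k + m" by (rule that)
  have "int n - int j = int (j + k + m)" "int n - int k - int j = int (j + m)"
    "int n - int k - 2 * int j = int m" "n - k - 2 * j = m" "n - 2 * j = k + m"
    using n by simp_all
  then show "(- 1) ^ j * sqrt (1 - q) ^ (n - 2 * j) * q ^ (j * (j + 1) div 2)
        * q_binom q (int n - int j) (int n - int k - int j)
        * q_binom q (int n - int k - int j) (int n - int k - 2 * int j)
        * \<rho> ^ (n - k - 2 * j) * q_Hermite q (n - k - 2 * j) y * f k
      = D_term q j k (n - k - 2 * j) * (\<rho> ^ (n - k - 2 * j) * q_Hermite q (n - k - 2 * j) y) * f k"
    by (simp only: D_term_def q_binom_mult_q_binom[symmetric] mult_ac)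
qed

lemma sum_C_coeff_eq:
  assumes "0 < n"
  shows "(\<Sum>k = 0..n. C_coeff k n y \<rho> q * f k)
    = (\<Sum>(j, k, m)\<in>triples n. C_term q \<rho> j k m * (\<rho> ^ m * q_Hermite q m y) * f k)"
  unfolding sum_triples C_coeff_def if_not_P[OF assms[THEN less_not_refl2]] sum_distrib_right
proof (intro sum.cong refl)
  fix k j assume "k \<in> {0..n}" "j \<in> {0..(n - k) div 2}"
  then have "n = 2 * j + k + (n - k - 2 * j)" by auto
  then obtain m where n: "n = 2 * j + k + m" by (rule that)
  \<comment> \<open>Splitting off an even multiple of 2j lets the integer division pass through,
    although j(j - 3) may be negative.\<close>
  have "int (j * (j + 1)) = int j * (int j - 3) + 2 * (2 * int j)"
    by (simp add: algebra_simps)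
  then have "int (j * (j + 1) div 2) = (int j * (int j - 3) + 2 * (2 * int j)) div 2"
    by (simp only: zdiv_int of_nat_numeral)
  also have "\<dots> = 2 * int j + (int j * (int j - 3)) div 2"
    by (rule div_mult_self2) simp
  finally have "int n - int k + (int j * (int j - 3)) div 2 = int (m + j * (j + 1) div 2)"
    using n by simp
  then have e: "q powi (int n - int k + (int j * (int j - 3)) div 2) = q ^ (m + j * (j + 1) div 2)"
    by (simp only: power_int_of_nat)
  have "int n - 1 - int j = int (j + k + m) - 1"
    "int n - int k - 2 * int j = int m" "n - k - 2 * j = m" "n - 2 * j = k + m"
    using n by simp_all
  then show "(- 1) ^ j * sqrt (1 - q) ^ (n - 2 * j)
        * q powi (int n - int k + (int j * (int j - 3)) div 2)
        * q_binom q (int n - 1 - int j) (int n - int k - 2 * int j)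
        * (q_binom q (int j + int k) (int k)
             - \<rho>\<^sup>2 * q ^ k * q_binom q (int j + int k - 1) (int k))
        * \<rho> ^ (n - k - 2 * j) * q_Hermite q (n - k - 2 * j) y * f k
      = C_term q \<rho> j k (n - k - 2 * j) * (\<rho> ^ (n - k - 2 * j) * q_Hermite q (n - k - 2 * j) y) * f k"
    unfolding e by (simp only: C_term_def mult_ac)
qed

section \<open>The two expansions\<close>

text \<open>The product y H_m splits into H_{m+1} and [m]_q H_{m-1}; shifting \<open>m\<close> gives
  the two sums. The weight \<open>f\<close> stays free because it is q^k P_k in the first expansion
  and P_k in the second.\<close>

lemma sum_triples_mult_y:
  "\<rho> * (y * sqrt (1 - q)) * (\<Sum>(j, k, m)\<in>triples (Suc n). D_term q j k m * (\<rho> ^ m * q_Hermite q m y) * f k)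
    = (\<Sum>(j, k, m)\<in>triples (Suc (Suc n)).
         (if m = 0 then 0 else sqrt (1 - q) * D_term q j k (m - 1)) * (\<rho> ^ m * q_Hermite q m y) * f k)
      + (\<Sum>(j, k, m)\<in>triples n.
         \<rho>\<^sup>2 * (1 - q ^ Suc (j + k + m)) * (D_term q j k m * (\<rho> ^ m * q_Hermite q m y) * f k))"
    (is "?L = ?A + ?B")
proof -
  let ?s = "sqrt (1 - q)"
  let ?h = "\<lambda>m. \<rho> ^ m * q_Hermite q m y"
  \<comment> \<open>The lowered term gains \<rho>^2, since \<rho>^m is part of
    \<open>?h\<close>.\<close>
  have h: "\<rho> * y * ?h m = ?h (Suc m) + \<rho>\<^sup>2 * q_nat q m * ?h (m - 1)" for m
    using mult_q_Hermite[of y q m] by (cases m) (simp_all add: algebra_simps power2_eq_square)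
  have A: "?A = (\<Sum>(j, k, m)\<in>triples (Suc n). ?s * D_term q j k m * ?h (Suc m) * f k)"
    by (subst sum_triples_third) simp_all
  have B: "?B = (\<Sum>(j, k, m)\<in>triples (Suc n).
      \<rho>\<^sup>2 * (?s * (q_nat q m * D_term q j k m)) * ?h (m - 1) * f k)"
  proof -
    have *: "\<rho>\<^sup>2 * (1 - q ^ Suc (j + k + m)) * (D_term q j k m * ?h m * f k)
        = \<rho>\<^sup>2 * (?s * (q_nat q (Suc m) * D_term q j k (Suc m))) * ?h (Suc m - 1) * f k" for j k m
      unfolding D_term_Suc(2) by simp
    show ?thesis
      unfolding * by (rule sum_triples_third[symmetric]) simp
  qed
  have "?L = (\<Sum>(j, k, m)\<in>triples (Suc n). ?s * D_term q j k m * (\<rho> * y * ?h m) * f k)"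
    by (simp add: sum_distrib_left split_def mult_ac)
  also have "\<dots> = ?A + ?B"
    unfolding A B h sum.distrib[symmetric]
    by (intro sum.cong) (auto simp: algebra_simps)
  finally show ?thesis .
qed

lemma Cheb_U_triples:
  "Cheb_U n (x * sqrt (1 - q) / 2)
    = (\<Sum>(j, k, m)\<in>triples n. D_term q j k m * (\<rho> ^ m * q_Hermite q m y) * ASC k x y \<rho> q)"
proof (induction n rule: less_induct)
  case (less n)
  let ?s = "sqrt (1 - q)"
  let ?h = "\<lambda>m. \<rho> ^ m * q_Hermite q m y"
  let ?P = "\<lambda>k. ASC k x y \<rho> q"
  let ?U = "\<lambda>n. Cheb_U n (x * ?s / 2)"
  consider "n = 0" | "n = Suc 0" | i where "n = Suc (Suc i)"
    by (metis not0_implies_Suc)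
  then show ?case
  proof cases
    case 1
    then show ?thesis by (simp add: sum_triples D_term_def q_trinom_def)
  next
    case 2
    then show ?thesis
      by (simp add: sum_triples D_term_def q_trinom_def q_nat_def algebra_simps)
  next
    case 3
    let ?N = "Suc (Suc i)"
    \<comment> \<open>The contribution of P_{k-1} in x P_k, with \<open>k\<close> shifted so that it
      can be compared with U_i.\<close>
    have third: "(\<Sum>(j, k, m)\<in>triples (Suc i).
          ?s * D_term q j k m * ?h m * ((1 - \<rho>\<^sup>2 * q ^ (k - 1)) * q_nat q k * ?P (k - 1)))
        = (\<Sum>(j, k, m)\<in>triples i.
          (1 - \<rho>\<^sup>2 * q ^ k) * (1 - q ^ Suc (j + k + m)) * (D_term q j k m * ?h m * ?P k))"
    proof -
      have *: "(1 - \<rho>\<^sup>2 * q ^ k) * (1 - q ^ Suc (j + k + m)) * (D_term q j k m * ?h m * ?P k)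
          = ?s * D_term q j (Suc k) m * ?h m
            * ((1 - \<rho>\<^sup>2 * q ^ (Suc k - 1)) * q_nat q (Suc k) * ?P (Suc k - 1))" for j k m
      proof -
        have "(1 - \<rho>\<^sup>2 * q ^ k) * (1 - q ^ Suc (j + k + m)) * (D_term q j k m * ?h m * ?P k)
          = (1 - \<rho>\<^sup>2 * q ^ k) * ((1 - q ^ Suc (j + k + m)) * D_term q j k m) * ?h m * ?P k"
          by (simp only: mult_ac)
        then show ?thesis
          unfolding D_term_Suc(1)[symmetric] by (simp only: diff_Suc_1 mult_ac)
      qed
      show ?thesis
        unfolding * by (rule sum_triples_second) simp
    qed
    have "?U ?N = x * ?s * ?U (Suc i) - ?U i" by simp
    also have "x * ?s * ?U (Suc i) = (\<Sum>(j, k, m)\<in>triples (Suc i). ?s * D_term q j k m * ?h m * (x * ?P k))"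
      using less[of "Suc i"] 3 by (simp add: sum_distrib_left split_def mult_ac)
    also have "\<dots> = (\<Sum>(j, k, m)\<in>triples (Suc i). ?s * D_term q j k m * ?h m * ?P (Suc k))
        + \<rho> * (y * ?s) * (\<Sum>(j, k, m)\<in>triples (Suc i). D_term q j k m * ?h m * (q ^ k * ?P k))
        + (\<Sum>(j, k, m)\<in>triples (Suc i).
            ?s * D_term q j k m * ?h m * ((1 - \<rho>\<^sup>2 * q ^ (k - 1)) * q_nat q k * ?P (k - 1)))"
      unfolding mult_ASC sum_distrib_left sum.distrib[symmetric]
      by (intro sum.cong) (auto simp: algebra_simps)
    also have "(\<Sum>(j, k, m)\<in>triples (Suc i). ?s * D_term q j k m * ?h m * ?P (Suc k))
        = (\<Sum>(j, k, m)\<in>triples ?N. (if k = 0 then 0 else ?s * D_term q j (k - 1) m) * ?h m * ?P k)"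
      by (subst sum_triples_second) simp_all
    finally have "?U ?N
        = (\<Sum>(j, k, m)\<in>triples ?N. (if k = 0 then 0 else ?s * D_term q j (k - 1) m) * ?h m * ?P k)
        + (\<Sum>(j, k, m)\<in>triples ?N. (if m = 0 then 0 else ?s * D_term q j k (m - 1)) * ?h m * (q ^ k * ?P k))
        + ((\<Sum>(j, k, m)\<in>triples i.
            \<rho>\<^sup>2 * (1 - q ^ Suc (j + k + m)) * (D_term q j k m * ?h m * (q ^ k * ?P k)))
        + (\<Sum>(j, k, m)\<in>triples i.
            (1 - \<rho>\<^sup>2 * q ^ k) * (1 - q ^ Suc (j + k + m)) * (D_term q j k m * ?h m * ?P k))
        - ?U i)"
      unfolding sum_triples_mult_y third by simp
    \<comment> \<open>The cancellation: with N = j + k + m + 1, \<rho>^2 q^k (1 - q^N) + (1 -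
      \<rho>^2 q^k)(1 - q^N) - 1 = -q^N.\<close>
    also have "(\<Sum>(j, k, m)\<in>triples i.
            \<rho>\<^sup>2 * (1 - q ^ Suc (j + k + m)) * (D_term q j k m * ?h m * (q ^ k * ?P k)))
        + (\<Sum>(j, k, m)\<in>triples i.
            (1 - \<rho>\<^sup>2 * q ^ k) * (1 - q ^ Suc (j + k + m)) * (D_term q j k m * ?h m * ?P k))
        - ?U i
        = (\<Sum>(j, k, m)\<in>triples i. - (q ^ Suc (j + k + m) * D_term q j k m * ?h m * ?P k))"
      unfolding less[of i, simplified 3, simplified] sum.distrib[symmetric] sum_subtractf[symmetric]
      by (intro sum.cong) (auto simp: algebra_simps)
    also have "\<dots> = (\<Sum>(j, k, m)\<in>triples ?N.
        - ((if j = 0 then 0 else q ^ (j + k + m) * D_term q (j - 1) k m) * ?h m * ?P k))"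
      by (subst sum_triples_first) simp_all
    finally have "?U ?N = (\<Sum>(j, k, m)\<in>triples ?N.
        ((if k = 0 then 0 else ?s * D_term q j (k - 1) m)
          + (if m = 0 then 0 else ?s * q ^ k * D_term q j k (m - 1))
          - (if j = 0 then 0 else q ^ (j + k + m) * D_term q (j - 1) k m)) * ?h m * ?P k)"
      unfolding sum.distrib[symmetric]
      by (elim trans, intro sum.cong) (auto simp: algebra_simps)
    also have "\<dots> = (\<Sum>(j, k, m)\<in>triples ?N. D_term q j k m * ?h m * ?P k)"
    proof (intro sum.cong refl, clarify)
      fix j k m assume "(j, k, m) \<in> triples ?N"
      then have "0 < j + k + m" by (auto simp: triples_def)
      from D_term_Pascal[OF this]
      show "((if k = 0 then 0 else ?s * D_term q j (k - 1) m)
          + (if m = 0 then 0 else ?s * q ^ k * D_term q j k (m - 1))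
          - (if j = 0 then 0 else q ^ (j + k + m) * D_term q (j - 1) k m)) * ?h m * ?P k
          = D_term q j k m * ?h m * ?P k"
        by simp
    qed
    finally show ?thesis unfolding 3 .
  qed
qed

lemma k_poly_triples:
  "k_poly (Suc (Suc n)) (x * sqrt (1 - q)) (y * sqrt (1 - q)) \<rho>
    = (\<Sum>(j, k, m)\<in>triples (Suc (Suc n)).
        C_term q \<rho> j k m * (\<rho> ^ m * q_Hermite q m y) * ASC k x y \<rho> q)"
proof -
  let ?N = "Suc (Suc n)"
  let ?s = "sqrt (1 - q)"
  let ?h = "\<lambda>m. \<rho> ^ m * q_Hermite q m y"
  let ?P = "\<lambda>k. ASC k x y \<rho> q"
  have "k_poly ?N (x * ?s) (y * ?s) \<rho>
      = (\<Sum>(j, k, m)\<in>triples ?N. D_term q j k m * ?h m * ?P k)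
        - (\<Sum>(j, k, m)\<in>triples ?N. (if m = 0 then 0 else ?s * D_term q j k (m - 1)) * ?h m * ?P k)
        + (\<rho>\<^sup>2 * (\<Sum>(j, k, m)\<in>triples n. D_term q j k m * ?h m * ?P k)
          - (\<Sum>(j, k, m)\<in>triples n.
              \<rho>\<^sup>2 * (1 - q ^ Suc (j + k + m)) * (D_term q j k m * ?h m * ?P k)))"
    unfolding k_poly_eq_Cheb_U Cheb_U_triples[where \<rho> = \<rho> and y = y] sum_triples_mult_y by simp
  \<comment> \<open>Here U_{n-2} meets the lowered part of y U_{n-1}: \<rho>^2 - \<rho>^2 (1 - q^N)
    = \<rho>^2 q^N, again with N = j + k + m + 1.\<close>
  also have "\<rho>\<^sup>2 * (\<Sum>(j, k, m)\<in>triples n. D_term q j k m * ?h m * ?P k)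
          - (\<Sum>(j, k, m)\<in>triples n.
              \<rho>\<^sup>2 * (1 - q ^ Suc (j + k + m)) * (D_term q j k m * ?h m * ?P k))
      = (\<Sum>(j, k, m)\<in>triples n. \<rho>\<^sup>2 * q ^ Suc (j + k + m) * D_term q j k m * ?h m * ?P k)"
    unfolding sum_distrib_left sum_subtractf[symmetric]
    by (intro sum.cong) (auto simp: algebra_simps)
  also have "\<dots> = (\<Sum>(j, k, m)\<in>triples ?N.
      (if j = 0 then 0 else \<rho>\<^sup>2 * q ^ (j + k + m) * D_term q (j - 1) k m) * ?h m * ?P k)"
    by (subst sum_triples_first) simp_all
  finally show ?thesis
    unfolding sum.distrib[symmetric] sum_subtractf[symmetric]
  proof (elim trans, intro sum.cong refl, clarify)
    fix j k m assume "(j, k, m) \<in> triples ?N"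
    then have "0 < j + k + m" by (auto simp: triples_def)
    from C_term_eq_D_term[OF this, of \<rho>]
    show "D_term q j k m * ?h m * ?P k
        - (if m = 0 then 0 else ?s * D_term q j k (m - 1)) * ?h m * ?P k
        + (if j = 0 then 0 else \<rho>\<^sup>2 * q ^ (j + k + m) * D_term q (j - 1) k m) * ?h m * ?P k
        = C_term q \<rho> j k m * ?h m * ?P k"
      by (simp only: distrib_right left_diff_distrib)
  qed
qed

end

theorem lemma3:
  fixes q \<rho> x y :: real and n :: nat
  assumes "- 1 < q" and "q \<le> 1" and "\<bar>\<rho>\<bar> < 1"
  shows "Cheb_U n (x * sqrt (1 - q) / 2) = (\<Sum>k = 0..n. D_coeff k n y \<rho> q * ASC k x y \<rho> q)
    \<and> k_poly n (x * sqrt (1 - q)) (y * sqrt (1 - q)) \<rho>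
        = (\<Sum>k = 0..n. C_coeff k n y \<rho> q * ASC k x y \<rho> q)"
proof
  show "Cheb_U n (x * sqrt (1 - q) / 2) = (\<Sum>k = 0..n. D_coeff k n y \<rho> q * ASC k x y \<rho> q)"
    unfolding sum_D_coeff_eq[OF assms(1,2)] by (rule Cheb_U_triples[OF assms(1,2)])
  \<comment> \<open>The Chebyshev formula for k_n involves U_{n-2}, so n = 0 and n = 1 are computed
    directly. At n = 0 the general sum would be 0, as \<open>q_binom q (-1) 0 = 0\<close>, whence
    the separate value of C_{0,0}.\<close>
  consider "n = 0" | "n = Suc 0" | i where "n = Suc (Suc i)"
    by (metis not0_implies_Suc)
  then show "k_poly n (x * sqrt (1 - q)) (y * sqrt (1 - q)) \<rho>
        = (\<Sum>k = 0..n. C_coeff k n y \<rho> q * ASC k x y \<rho> q)"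
  proof cases
    case 1
    then show ?thesis by (simp add: k_poly_def C_coeff_def)
  next
    case 2
    then show ?thesis
      by (simp add: k_poly_def C_coeff_def q_binom_def q_nat_def algebra_simps)
  next
    case 3
    show ?thesis
      unfolding 3 sum_C_coeff_eq[OF assms(1,2) zero_less_Suc] by (rule k_poly_triples[OF assms(1,2)])
  qed
qed

end
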